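(* Let $n\ge 1$, let $\mathcal{L} \subset \mathbb{R}^{2n}$ be a Lagrangian subspace and $\mathbf{B} = (x_1, \ldots , x_n)$ some ordered basis of $\mathcal{L}$. Let $X_L = [\,x_1 \; \cdots \; x_{n-1}\,]$, $X_R = [\,x_2 \; \cdots \; x_n\,]$ in $\mathbb{R}^{2n\times(n-1)}$ and let $\widehat{H} := X_RX_L^+ + J_{2n}^T(X_RX_L^+)^TJ_{2n}\in \mathbb{R}^{2n \times 2n}$. Then $$ \Vert \widehat{H} \Vert_2 \leq \Vert H \Vert_2 \qquad \text{for all } H \in \mathbb{HK}(\mathbf{B}).$$
   Context: $J_{2n} = \begin{bmatrix} 0 & I_n \\ -I_n & 0 \end{bmatrix} \in \mathbb{R}^{2n\times 2n}$. A subspace $\mathcal{L}\subset\mathbb{R}^{2n}$ is called isotropic if $x^TJ_{2n}y = 0$ for all $x,y\in\mathcal{L}$, and Lagrangian if it is isotropic and of dimension $n$. A matrix $H\in\mathbb{R}^{2n\times 2n}$ is called skew-Hamiltonian if $J_{2n}^TH^TJ_{2n} = H$. For an ordered basis $\mathbf{B}=(x_1,\ldots,x_n)$ of a Lagrangian subspace, $\mathbb{HK}(\mathbf{B})$ denotes the set of all skew-Hamiltonian matrices $H\in\mathbb{R}^{2n\times 2n}$ satisfying $Hx_k = x_{k+1}$ for all $k=1,\ldots,n-1$. $A^+$ denotes the Moore-Penrose pseudoinverse of $A$ and $\Vert A\Vert_2 = \max_{\Vert x\Vert_2=1}\Vert Ax\Vert_2$ the spectral norm. (For $n=1$ the matrices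 $X_L,X_R$ have no columns and $X_RX_L^+$ is the zero matrix.) *)

theory Defs
  imports Complex_Main "Jordan_Normal_Form.VS_Connect"
begin

definition vec_norm2 :: "real vec \<Rightarrow> real" where
  "vec_norm2 v = sqrt (v \<bullet> v)"

(* The unit sphere is compact, so the supremum is a maximum. The unit sphere is nonempty,
   and hence the supremum meaningful, whenever A has at least one column. *)
definition spectral_norm :: "real mat \<Rightarrow> real" where
  "spectral_norm A = (SUP x \<in> {x \<in> carrier_vec (dim_col A). vec_norm2 x = 1}. vec_norm2 (A *\<^sub>v x))"

(* The four Penrose equations; every real matrix has exactly one such P,
   also when one of the dimensions is 0. *)
definition is_pseudoinverse :: "real mat \<Rightarrow> real mat \<Rightarrow> bool" where
  "is_pseudoinverse A P \<longleftrightarrow>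
     P \<in> carrier_mat (dim_col A) (dim_row A) \<and>
     A * P * A = A \<and>
     P * A * P = P \<and>
     (A * P)\<^sup>T = A * P \<and>
     (P * A)\<^sup>T = P * A"

definition pseudoinverse :: "real mat \<Rightarrow> real mat" where
  "pseudoinverse A = (THE P. is_pseudoinverse A P)"

definition J_mat :: "nat \<Rightarrow> real mat" where
  "J_mat n = four_block_mat (0\<^sub>m n n) (1\<^sub>m n) (- 1\<^sub>m n) (0\<^sub>m n n)"

abbreviation real_space :: "nat \<Rightarrow> (real, real vec) module" where
  "real_space d \<equiv> module_vec TYPE(real) d"

definition isotropic :: "nat \<Rightarrow> real vec set \<Rightarrow> bool" where
  "isotropic n L \<longleftrightarrow>
     VectorSpace.subspace class_ring L (real_space (2 * n)) \<and>
     (\<forall>x \<in> L. \<forall>y \<in> L. x \<bullet> (J_mat n *\<^sub>v y) = 0)"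

definition lagrangian :: "nat \<Rightarrow> real vec set \<Rightarrow> bool" where
  "lagrangian n L \<longleftrightarrow>
     isotropic n L \<and> vectorspace.dim class_ring ((real_space (2 * n))\<lparr>carrier := L\<rparr>) = n"

(* Repetitions have to be excluded separately, since a basis in the library is a set. *)
definition ordered_basis :: "nat \<Rightarrow> real vec set \<Rightarrow> real vec list \<Rightarrow> bool" where
  "ordered_basis d L xs \<longleftrightarrow>
     distinct xs \<and> vectorspace.basis class_ring ((real_space d)\<lparr>carrier := L\<rparr>) (set xs)"

definition skew_hamiltonian :: "nat \<Rightarrow> real mat \<Rightarrow> bool" where
  "skew_hamiltonian n H \<longleftrightarrow>
     H \<in> carrier_mat (2 * n) (2 * n) \<and> (J_mat n)\<^sup>T * H\<^sup>T * J_mat n = H"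

(* Lists are indexed from 0, so the vector x_k is xs ! (k - 1). *)
definition HK :: "nat \<Rightarrow> real vec list \<Rightarrow> real mat set" where
  "HK n xs = {H. skew_hamiltonian n H \<and> (\<forall>k \<in> {1..<n}. H *\<^sub>v (xs ! (k - 1)) = xs ! k)}"

definition X_L :: "nat \<Rightarrow> real vec list \<Rightarrow> real mat" where
  "X_L n xs = mat_of_cols (2 * n) (butlast xs)"

definition X_R :: "nat \<Rightarrow> real vec list \<Rightarrow> real mat" where
  "X_R n xs = mat_of_cols (2 * n) (tl xs)"

definition H_hat :: "nat \<Rightarrow> real vec list \<Rightarrow> real mat" where
  "H_hat n xs =
     X_R n xs * pseudoinverse (X_L n xs)
     + (J_mat n)\<^sup>T * (X_R n xs * pseudoinverse (X_L n xs))\<^sup>T * J_mat n"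

end

theory Submission
  imports Defs "Jordan_Normal_Form.DL_Rank"
begin

text \<open>
  Let \<open>E = X\<^sub>L X\<^sub>L\<^sup>+\<close> be the orthogonal projection onto the span of the first \<open>n - 1\<close> basis
  vectors and \<open>Q = J\<^sup>T E J\<close>. For every admissible \<open>H\<close> the matrix in question is
  \<open>H E + Q H\<close>, because \<open>X\<^sub>R = H X\<^sub>L\<close> and \<open>H\<close> is skew-Hamiltonian. Since the basis spans an
  isotropic subspace, \<open>Q H E = 0\<close>. Hence \<open>H E x\<close> and \<open>Q H x = Q H (x - E x)\<close> are orthogonal, and
  Pythagoras bounds the squared norm of their sum by
  \<open>\<parallel>H\<parallel>\<^sup>2 (\<parallel>E x\<parallel>\<^sup>2 + \<parallel>x - E x\<parallel>\<^sup>2) = \<parallel>H\<parallel>\<^sup>2 \<parallel>x\<parallel>\<^sup>2\<close>.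
\<close>

section \<open>Euclidean norm and spectral norm\<close>

lemma scalar_prod_self_nonneg: "0 \<le> (v :: real vec) \<bullet> v"
  by (simp add: scalar_prod_def sum_nonneg)

lemma scalar_prod_self_eq_0:
  assumes "v \<in> carrier_vec m" "(v :: real vec) \<bullet> v = 0"
  shows "v = 0\<^sub>v m"
  using conjugate_square_eq_0_vec[OF assms(1)] assms(2) by simp

lemma vec_norm2_nonneg: "0 \<le> vec_norm2 v"
  by (simp add: vec_norm2_def scalar_prod_self_nonneg)

lemma vec_norm2_squared: "(vec_norm2 v)\<^sup>2 = v \<bullet> v"
  by (simp add: vec_norm2_def scalar_prod_self_nonneg)

lemma vec_norm2_smult: "vec_norm2 (c \<cdot>\<^sub>v v) = \<bar>c\<bar> * vec_norm2 v"
  by (simp add: vec_norm2_def real_sqrt_mult flip: mult.assoc power2_eq_square)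

text \<open>Each squared entry of \<open>x\<close> is a summand of \<open>x \<bullet> x\<close>, so
  no entry exceeds 1 in absolute value. The crude bound suffices, since it only has to be uniform in
  \<open>x\<close>.\<close>

lemma scalar_prod_le_sum_abs:
  assumes "(x :: real vec) \<bullet> x \<le> 1"
  shows "\<bar>v \<bullet> x\<bar> \<le> (\<Sum>i<dim_vec x. \<bar>v $ i\<bar>)"
proof -
  have "\<bar>x $ i\<bar> \<le> 1" if "i < dim_vec x" for i
  proof -
    have "(x $ i)\<^sup>2 \<le> (\<Sum>i<dim_vec x. (x $ i)\<^sup>2)"
      using that by (intro member_le_sum) auto
    then have "(x $ i)\<^sup>2 \<le> 1"
      using assms by (simp add: scalar_prod_def power2_eq_square atLeast0LessThan)
    then show ?thesis
      by (simp add: abs_square_le_1)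
  qed
  then have "(\<Sum>i<dim_vec x. \<bar>v $ i * x $ i\<bar>) \<le> (\<Sum>i<dim_vec x. \<bar>v $ i\<bar>)"
    by (intro sum_mono) (simp add: abs_mult mult_left_le)
  then show ?thesis
    unfolding scalar_prod_def atLeast0LessThan by (rule order_trans[OF sum_abs])
qed

text \<open>A real \<open>SUP\<close> bounds its members only when the set is bounded above; the
  bound is assembled row by row.\<close>

lemma spectral_norm_bdd_above:
  "bdd_above ((\<lambda>x. vec_norm2 (A *\<^sub>v x)) ` {x \<in> carrier_vec (dim_col A). vec_norm2 x = 1})"
proof (rule bdd_aboveI2)
  fix x assume x: "x \<in> {x \<in> carrier_vec (dim_col A). vec_norm2 x = 1}"
  then have xx: "x \<bullet> x = 1"
    using vec_norm2_squared[of x] by simp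
  have "(A *\<^sub>v x) \<bullet> (A *\<^sub>v x) = (\<Sum>i<dim_row A. (row A i \<bullet> x)\<^sup>2)"
    by (simp add: scalar_prod_def[of "A *\<^sub>v x"] power2_eq_square atLeast0LessThan)
  also have "\<dots> \<le> (\<Sum>i<dim_row A. (\<Sum>j<dim_col A. \<bar>row A i $ j\<bar>)\<^sup>2)"
  proof (rule sum_mono)
    fix i
    have "\<bar>row A i \<bullet> x\<bar> \<le> (\<Sum>j<dim_col A. \<bar>row A i $ j\<bar>)"
      using scalar_prod_le_sum_abs[of x "row A i"] x xx by auto
    then show "(row A i \<bullet> x)\<^sup>2 \<le> (\<Sum>j<dim_col A. \<bar>row A i $ j\<bar>)\<^sup>2"
      using power_mono[of _ _ 2, OF _ abs_ge_zero] by fastforce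
  qed
  finally show "vec_norm2 (A *\<^sub>v x) \<le> sqrt (\<Sum>i<dim_row A. (\<Sum>j<dim_col A. \<bar>row A i $ j\<bar>)\<^sup>2)"
    by (simp add: vec_norm2_def)
qed

text \<open>Normalising \<open>x\<close> moves it to the unit sphere, where the supremum applies.
  The zero vector is treated apart, which also covers \<open>m = 0\<close>, where the sphere is
  empty.\<close>

lemma vec_norm2_mult_mat_vec_le:
  assumes "A \<in> carrier_mat r m" "x \<in> carrier_vec m"
  shows "vec_norm2 (A *\<^sub>v x) \<le> spectral_norm A * vec_norm2 x"
proof (cases "vec_norm2 x = 0")
  case True
  then have "x = 0\<^sub>v m"
    using vec_norm2_squared[of x] assms(2) by (simp add: scalar_prod_self_eq_0)
  with assms(1) have "A *\<^sub>v x = 0\<^sub>v r"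
    by auto
  with True show ?thesis
    by (simp add: vec_norm2_def)
next
  case False
  define y where "y = (1 / vec_norm2 x) \<cdot>\<^sub>v x"
  have pos: "0 < vec_norm2 x"
    using False vec_norm2_nonneg[of x] by simp
  have "vec_norm2 y = 1"
    using pos by (simp add: y_def vec_norm2_smult)
  moreover have "y \<in> carrier_vec m"
    using assms(2) by (simp add: y_def)
  ultimately have "vec_norm2 (A *\<^sub>v y) \<le> spectral_norm A"
    unfolding spectral_norm_def using assms(1)
    by (intro cSUP_upper spectral_norm_bdd_above) auto
  moreover have "A *\<^sub>v y = (1 / vec_norm2 x) \<cdot>\<^sub>v (A *\<^sub>v x)"
    unfolding y_def by (rule mult_mat_vec[OF assms])
  ultimately show ?thesis
    using pos by (simp add: vec_norm2_smult field_simps)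
qed

text \<open>The supremum is the least upper bound; \<open>0 < m\<close> supplies a unit vector, so
  that it is taken over a nonempty set.\<close>

lemma spectral_norm_le:
  assumes "A \<in> carrier_mat r m" "0 < m"
    and "\<And>x. x \<in> carrier_vec m \<Longrightarrow> vec_norm2 (A *\<^sub>v x) \<le> c * vec_norm2 x"
  shows "spectral_norm A \<le> c"
  unfolding spectral_norm_def
proof (rule cSUP_least)
  have "unit_vec m 0 \<in> {x \<in> carrier_vec (dim_col A). vec_norm2 x = 1}"
    using assms(1,2) by (simp add: vec_norm2_def)
  then show "{x \<in> carrier_vec (dim_col A). vec_norm2 x = 1} \<noteq> {}"
    by blast
qed (use assms(1,3) in force)

lemma spectral_norm_nonneg:
  assumes "A \<in> carrier_mat r m" "0 < m"
  shows "0 \<le> spectral_norm A"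
  using vec_norm2_mult_mat_vec_le[OF assms(1), of "unit_vec m 0"] assms(2)
    vec_norm2_nonneg[of "A *\<^sub>v unit_vec m 0"]
  by (simp add: vec_norm2_def[of "unit_vec m 0"])

section \<open>Adjoints and orthogonal projections\<close>

lemma scalar_prod_mult_mat_vec:
  assumes "A \<in> carrier_mat r m" "x \<in> carrier_vec m" "y \<in> carrier_vec r"
  shows "(A *\<^sub>v x) \<bullet> (y :: real vec) = x \<bullet> (A\<^sup>T *\<^sub>v y)"
  using transpose_vec_mult_scalar[OF assms(1,2,3)] assms
  by (metis comm_scalar_prod mult_mat_vec_carrier transpose_carrier_mat)

lemma orthogonal_projection_Pythagoras:
  assumes "E \<in> carrier_mat m m" "E\<^sup>T = E" "E * E = E" "x \<in> carrier_vec m"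
  shows "(x :: real vec) \<bullet> x = (E *\<^sub>v x) \<bullet> (E *\<^sub>v x) + (x - E *\<^sub>v x) \<bullet> (x - E *\<^sub>v x)"
proof -
  have Ex: "E *\<^sub>v x \<in> carrier_vec m"
    using assms by simp
  have "(E *\<^sub>v x) \<bullet> (E *\<^sub>v x) = x \<bullet> (E *\<^sub>v (E *\<^sub>v x))"
    using scalar_prod_mult_mat_vec[OF assms(1,4) Ex] assms(2) by simp
  also have "E *\<^sub>v (E *\<^sub>v x) = E *\<^sub>v x"
    using assoc_mult_mat_vec[OF assms(1,1,4)] assms(3) by simp
  finally have "(E *\<^sub>v x) \<bullet> (E *\<^sub>v x) = x \<bullet> (E *\<^sub>v x)" .
  moreover have "(E *\<^sub>v x) \<bullet> x = x \<bullet> (E *\<^sub>v x)"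
    using Ex assms(4) by (rule comm_scalar_prod)
  ultimately show ?thesis
    using Ex assms(4)
    by (simp add: minus_scalar_prod_distrib[where n = m] scalar_prod_minus_distrib[where n = m])
qed

section \<open>Moore-Penrose pseudoinverse\<close>

text \<open>\<open>A * P\<close> and \<open>A * Q\<close> are both the orthogonal projection onto
  the column space of \<open>A\<close>, and \<open>P * A\<close> and \<open>Q * A\<close> both the
  one onto its row space. Hence \<open>P = P * A * P = Q * A * Q = Q\<close>.\<close>

lemma is_pseudoinverse_unique:
  assumes P: "is_pseudoinverse A P" and Q: "is_pseudoinverse A Q"
  shows "P = Q"
proof -
  define r c where "r = dim_row A" and "c = dim_col A"
  have [simp]: "A \<in> carrier_mat r c" "P \<in> carrier_mat c r" "Q \<in> carrier_mat c r"
    using P Q by (auto simp: is_pseudoinverse_def r_def c_def)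
  then have [simp]: "A * P \<in> carrier_mat r r" "A * Q \<in> carrier_mat r r"
    "P * A \<in> carrier_mat c c" "Q * A \<in> carrier_mat c c"
    by (blast intro: mult_carrier_mat)+
  note pen = P[unfolded is_pseudoinverse_def] Q[unfolded is_pseudoinverse_def]
  have AP: "A * P = A * Q"
  proof -
    have "A * P = (A * Q * A) * P" using pen by simp
    also have "\<dots> = (A * Q) * (A * P)" by (rule assoc_mult_mat[of _ r r _ c _ r]) auto
    \<comment> \<open>Symmetry of both factors lets transposition swap them, after which
      \<open>A * P * A\<close> collapses to \<open>A\<close>.\<close>
    also have "\<dots> = (A * Q)\<^sup>T * (A * P)\<^sup>T" using pen by simp
    also have "\<dots> = ((A * P) * (A * Q))\<^sup>T" by (rule transpose_mult[symmetric, of _ r r _ r]) auto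
    also have "(A * P) * (A * Q) = (A * P * A) * Q" by (rule assoc_mult_mat[symmetric, of _ r r _ c _ r]) auto
    also have "\<dots> = A * Q" using pen by simp
    finally show ?thesis using pen by simp
  qed
  have PA: "P * A = Q * A"
  proof -
    have "P * A = P * (A * Q * A)" using pen by simp
    also have "\<dots> = P * (A * (Q * A))" by (subst assoc_mult_mat[of _ r c _ r _ c]) auto
    also have "\<dots> = (P * A) * (Q * A)" by (rule assoc_mult_mat[symmetric, of _ c r _ c _ c]) auto
    also have "\<dots> = (P * A)\<^sup>T * (Q * A)\<^sup>T" using pen by simp
    also have "\<dots> = ((Q * A) * (P * A))\<^sup>T" by (rule transpose_mult[symmetric, of _ c c _ c]) auto
    also have "(Q * A) * (P * A) = Q * (A * (P * A))" by (rule assoc_mult_mat[of _ c r _ c _ c]) auto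
    also have "\<dots> = Q * (A * P * A)" by (subst assoc_mult_mat[of _ r c _ r _ c]) auto
    also have "\<dots> = Q * A" using pen by simp
    finally show ?thesis using pen by simp
  qed
  have "P = P * A * P" using pen by simp
  also have "\<dots> = Q * A * P" using PA by simp
  also have "\<dots> = Q * (A * P)" by (rule assoc_mult_mat[of _ c r _ c _ r]) auto
  also have "\<dots> = Q * A * Q" unfolding AP by (rule assoc_mult_mat[symmetric, of _ c r _ c _ r]) auto
  also have "\<dots> = Q" using pen by simp
  finally show ?thesis .
qed

text \<open>A trivial kernel makes the Gram matrix \<open>G\<close> invertible, and its inverse
  times \<open>A\<^sup>T\<close> is the pseudoinverse. The case \<open>c = 0\<close> is included, as
  needed for \<open>n = 1\<close>.\<close>

lemma is_pseudoinverse_exists_if_inj: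
  assumes A: "A \<in> carrier_mat r c"
    and inj: "\<And>v. v \<in> carrier_vec c \<Longrightarrow> A *\<^sub>v v = 0\<^sub>v r \<Longrightarrow> v = 0\<^sub>v c"
  shows "\<exists>P. is_pseudoinverse A P"
proof -
  define G where "G = A\<^sup>T * A"
  have G: "G \<in> carrier_mat c c" and At: "A\<^sup>T \<in> carrier_mat c r"
    using A by (auto simp: G_def)
  have "det G \<noteq> 0"
  proof
    assume "det G = 0"
    then obtain v where v: "v \<in> carrier_vec c" "v \<noteq> 0\<^sub>v c" "G *\<^sub>v v = 0\<^sub>v c"
      using det_0_iff_vec_prod_zero_field[OF G] by auto
    have Av: "A *\<^sub>v v \<in> carrier_vec r"
      using A v(1) by simp
    have "(A *\<^sub>v v) \<bullet> (A *\<^sub>v v) = v \<bullet> (A\<^sup>T *\<^sub>v (A *\<^sub>v v))"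
      by (rule scalar_prod_mult_mat_vec[OF A v(1) Av])
    also have "A\<^sup>T *\<^sub>v (A *\<^sub>v v) = G *\<^sub>v v"
      unfolding G_def by (rule assoc_mult_mat_vec[OF At A v(1), symmetric])
    finally have "(A *\<^sub>v v) \<bullet> (A *\<^sub>v v) = 0"
      using v by simp
    from scalar_prod_self_eq_0[OF Av this] inj v(1,2) show False
      by blast
  qed
  then have "G \<in> Units (ring_mat TYPE(real) c ())"
    by (rule det_non_zero_imp_unit[OF G])
  then obtain K where K: "K \<in> carrier_mat c c" and KG: "K * G = 1\<^sub>m c" and GK: "G * K = 1\<^sub>m c"
    by (auto simp: Units_def ring_mat_simps)
  have Gt: "G\<^sup>T = G"
    unfolding G_def using transpose_mult[OF At A] by simp
  \<comment> \<open>Transposing \<open>G * K = 1\<^sub>m c\<close> shows that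
    \<open>K\<^sup>T\<close> is a left inverse of the symmetric \<open>G\<close>, so it equals the
    right inverse \<open>K\<close>.\<close>
  have Kt: "K\<^sup>T = K"
  proof -
    have Kt: "K\<^sup>T \<in> carrier_mat c c" using K by simp
    have "K\<^sup>T * G = 1\<^sub>m c"
      using transpose_mult[OF G K] GK Gt by simp
    then have "K\<^sup>T * G * K = K"
      using K by simp
    then show ?thesis
      using assoc_mult_mat[OF Kt G K] GK Kt by simp
  qed
  define P where "P = K * A\<^sup>T"
  have P: "P \<in> carrier_mat c r"
    using K At by (simp add: P_def)
  \<comment> \<open>This settles all Penrose equations except the symmetry of \<open>A * P\<close>,
    which comes from that of \<open>K\<close>.\<close>
  have PA: "P * A = 1\<^sub>m c"
    unfolding P_def using assoc_mult_mat[OF K At A] KG by (simp add: G_def)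
  have "A * P = A * K * A\<^sup>T"
    unfolding P_def by (rule assoc_mult_mat[OF A K At, symmetric])
  moreover have "(A * P)\<^sup>T = A * K * A\<^sup>T"
    using Kt transpose_mult[OF A P] transpose_mult[OF K At] by (simp add: P_def)
  ultimately have "is_pseudoinverse A P"
    using A P PA assoc_mult_mat[OF A P A] by (simp add: is_pseudoinverse_def)
  then show ?thesis ..
qed

lemma is_pseudoinverse_pseudoinverse:
  assumes "is_pseudoinverse A P"
  shows "is_pseudoinverse A (pseudoinverse A)"
  unfolding pseudoinverse_def
  by (rule theI[of "is_pseudoinverse A", OF assms]) (rule is_pseudoinverse_unique[OF _ assms])

section \<open>The skew-Hamiltonian completion\<close>

lemma J_mat_carrier: "J_mat n \<in> carrier_mat (2 * n) (2 * n)"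
  unfolding J_mat_def mult_2 by (rule four_block_carrier_mat) auto

lemma J_mat_orthogonal: "J_mat n * (J_mat n)\<^sup>T = 1\<^sub>m (2 * n)"
proof -
  have "(J_mat n)\<^sup>T = four_block_mat (0\<^sub>m n n) (- 1\<^sub>m n) (1\<^sub>m n) (0\<^sub>m n n)"
    unfolding J_mat_def by (subst transpose_four_block_mat[of _ n n _ n _ n]) (auto simp: transpose_uminus)
  moreover have "J_mat n * four_block_mat (0\<^sub>m n n) (- 1\<^sub>m n) (1\<^sub>m n) (0\<^sub>m n n)
      = four_block_mat (1\<^sub>m n) (- 0\<^sub>m n n) (0\<^sub>m n n) (1\<^sub>m n)"
    unfolding J_mat_def by (subst mult_four_block_mat[of _ n n _ n _ n _ _ n _ n]) auto
  moreover have "four_block_mat (1\<^sub>m n) (0\<^sub>m n n) (0\<^sub>m n n) (1\<^sub>m n) = (1\<^sub>m (2 * n) :: real mat)"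
    by (rule eq_matI) (auto simp: mult_2)
  moreover have "- 0\<^sub>m n n = (0\<^sub>m n n :: real mat)"
    by (rule eq_matI) auto
  ultimately show ?thesis
    by simp
qed

text \<open>Isotropy enters only through \<open>iso\<close>, and membership in \<open>HK\<close>
  only through the assumptions on \<open>H\<close>. Bases do not appear; \<open>A\<close> and
  \<open>B\<close> stand for \<open>X_L\<close> and \<open>X_R\<close>.\<close>

lemma spectral_norm_completion_le:
  fixes J :: "real mat"
  assumes A: "A \<in> carrier_mat m k" and B: "B \<in> carrier_mat m k"
    and P: "is_pseudoinverse A P"
    and J: "J \<in> carrier_mat m m" "J * J\<^sup>T = 1\<^sub>m m"
    and H: "H \<in> carrier_mat m m" "J\<^sup>T * H\<^sup>T * J = H"
    and HA: "H * A = B"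
    and iso: "A\<^sup>T * (J * B) = 0\<^sub>m k k"
    and m: "0 < m"
  shows "spectral_norm (B * P + J\<^sup>T * (B * P)\<^sup>T * J) \<le> spectral_norm H"
proof -
  have Pc: "P \<in> carrier_mat k m"
    using P A by (simp add: is_pseudoinverse_def)
  define E where "E = A * P"
  define Q where "Q = J\<^sup>T * E * J"
  define M where "M = B * P"
  define N where "N = J\<^sup>T * M\<^sup>T * J"
  note c = A B J(1) Pc H(1)
  have Ec: "E \<in> carrier_mat m m" and Mc: "M \<in> carrier_mat m m"
    using c by (auto simp: E_def M_def)
  then have Qc: "Q \<in> carrier_mat m m" and Nc: "N \<in> carrier_mat m m"
    using c by (auto simp: Q_def N_def)
  have Jt: "J\<^sup>T \<in> carrier_mat m m" and Ht: "H\<^sup>T \<in> carrier_mat m m"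
    using c by auto
  have Et: "E\<^sup>T = E"
    using P by (simp add: E_def is_pseudoinverse_def)
  have APA: "A * P * A = A"
    using P by (simp add: is_pseudoinverse_def)
  have EE: "E * E = E"
    unfolding E_def using assoc_mult_mat[of "A * P" m m A k P m] c APA by simp
  have HE: "H * E = M"
    unfolding E_def M_def using assoc_mult_mat[OF H(1) A Pc] HA by simp
  have Qt: "Q\<^sup>T = Q"
    unfolding Q_def using c Ec Et by (simp add: transpose_mult[of _ m m _ m])
  \<comment> \<open>\<open>Q\<close> is the conjugate of the projection \<open>E\<close> by the
    orthogonal matrix \<open>J\<close>: the inner \<open>J * J\<^sup>T\<close> cancels.\<close>
  have QQ: "Q * Q = Q"
  proof -
    have "Q * Q = J\<^sup>T * (E * ((J * J\<^sup>T) * (E * J)))"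
      unfolding Q_def using c Ec Jt by (simp add: assoc_mult_mat[of _ m m _ m _ m])
    also have "\<dots> = J\<^sup>T * ((E * E) * J)"
      unfolding J(2) using c Ec by (simp add: assoc_mult_mat[of _ m m _ m _ m])
    also have "\<dots> = Q"
      unfolding Q_def EE using c Ec Jt by (simp add: assoc_mult_mat[of _ m m _ m _ m])
    finally show ?thesis .
  qed
  \<comment> \<open>Replacing \<open>H\<close> by \<open>J\<^sup>T * H\<^sup>T * J\<close> cancels
    an inner \<open>J * J\<^sup>T\<close> and leaves \<open>E * H\<^sup>T\<close>, the transpose of
    \<open>H * E = M\<close>.\<close>
  have NQH: "N = Q * H"
  proof -
    have "Q * H = Q * (J\<^sup>T * H\<^sup>T * J)"
      using H(2) by simp
    also have "\<dots> = J\<^sup>T * (E * ((J * J\<^sup>T) * (H\<^sup>T * J)))"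
      unfolding Q_def using c Ec Jt Ht by (simp add: assoc_mult_mat[of _ m m _ m _ m])
    also have "\<dots> = J\<^sup>T * ((E * H\<^sup>T) * J)"
      unfolding J(2) using c Ec Ht by (simp add: assoc_mult_mat[of _ m m _ m _ m])
    also have "E * H\<^sup>T = M\<^sup>T"
      using transpose_mult[OF H(1) Ec] HE Et by simp
    finally show ?thesis
      unfolding N_def using c Mc Jt by (simp add: assoc_mult_mat[of _ m m _ m _ m])
  qed
  \<comment> \<open>The product contains \<open>E * (J * B)\<close>. Symmetry of \<open>E\<close>
    gives \<open>E = P\<^sup>T * A\<^sup>T\<close>, which exposes the factor that vanishes by
    \<open>iso\<close>.\<close>
  have QM: "Q * M = 0\<^sub>m m m"
  proof -
    have EJB: "E * (J * B) = 0\<^sub>m m k"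
    proof -
      have "E = P\<^sup>T * A\<^sup>T"
        using transpose_mult[OF A Pc] Et by (simp add: E_def)
      then have "E * (J * B) = P\<^sup>T * (A\<^sup>T * (J * B))"
        using c assoc_mult_mat[of "P\<^sup>T" m k "A\<^sup>T" m "J * B" k] by simp
      then show ?thesis
        using iso Pc by simp
    qed
    have "Q * M = J\<^sup>T * ((E * (J * B)) * P)"
      unfolding Q_def M_def using c Ec Jt
      by (simp add: assoc_mult_mat[of _ m m _ m _ m] assoc_mult_mat[of _ m m _ m _ k]
          assoc_mult_mat[of _ m m _ k _ m])
    then show ?thesis
      unfolding EJB using Jt Pc by simp
  qed
  have NE: "N * E = 0\<^sub>m m m"
    unfolding NQH using assoc_mult_mat[OF Qc H(1) Ec] HE QM by simp
  define s where "s = spectral_norm H"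
  have s0: "0 \<le> s"
    unfolding s_def by (rule spectral_norm_nonneg[OF H(1) m])
  have Hle: "(H *\<^sub>v y) \<bullet> (H *\<^sub>v y) \<le> s\<^sup>2 * (y \<bullet> y)" if "y \<in> carrier_vec m" for y
    using power_mono[OF vec_norm2_mult_mat_vec_le[OF H(1) that] vec_norm2_nonneg, of 2]
    by (simp add: vec_norm2_squared power_mult_distrib s_def)
  have "spectral_norm (M + N) \<le> s"
  proof (rule spectral_norm_le[OF _ m])
    fix x :: "real vec" assume x: "x \<in> carrier_vec m"
    define y where "y = E *\<^sub>v x"
    define z where "z = x - E *\<^sub>v x"
    have y: "y \<in> carrier_vec m" and z: "z \<in> carrier_vec m"
      using x Ec by (auto simp: y_def z_def)
    have Mx: "M *\<^sub>v x = H *\<^sub>v y"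
      unfolding y_def HE[symmetric] by (rule assoc_mult_mat_vec[OF H(1) Ec x])
    \<comment> \<open>Since \<open>N * E = 0\<close>, \<open>N\<close> acts only on the component
      \<open>z\<close>, while \<open>M\<close> acts only on \<open>y\<close>; each component of
      \<open>x\<close> is thus charged once.\<close>
    have "N *\<^sub>v y = 0\<^sub>v m"
      unfolding y_def using assoc_mult_mat_vec[OF Nc Ec x, symmetric] NE x by auto
    then have "N *\<^sub>v z = N *\<^sub>v x"
      unfolding z_def using mult_minus_distrib_mat_vec[OF Nc x y] Nc x by (simp add: y_def)
    then have Nx: "N *\<^sub>v x = Q *\<^sub>v (H *\<^sub>v z)"
      unfolding NQH using assoc_mult_mat_vec[OF Qc H(1) z] by simp
    have Mxc: "M *\<^sub>v x \<in> carrier_vec m" and Nxc: "N *\<^sub>v x \<in> carrier_vec m"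
      and Hz: "H *\<^sub>v z \<in> carrier_vec m"
      using Mc Nc H(1) x z by auto
    \<comment> \<open>The symmetric \<open>Q\<close> is moved to the other factor, where it
      annihilates the range of \<open>M\<close>.\<close>
    have "(N *\<^sub>v x) \<bullet> (M *\<^sub>v x) = (H *\<^sub>v z) \<bullet> (Q *\<^sub>v (M *\<^sub>v x))"
      unfolding Nx using scalar_prod_mult_mat_vec[OF Qc Hz Mxc] Qt by simp
    also have "Q *\<^sub>v (M *\<^sub>v x) = 0\<^sub>v m"
      using assoc_mult_mat_vec[OF Qc Mc x, symmetric] QM x by auto
    finally have NM: "(N *\<^sub>v x) \<bullet> (M *\<^sub>v x) = 0"
      using Hz by simp
    have MN: "(M *\<^sub>v x) \<bullet> (N *\<^sub>v x) = 0"
      using comm_scalar_prod[OF Mxc Nxc] NM by simp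
    have "((M + N) *\<^sub>v x) \<bullet> ((M + N) *\<^sub>v x)
        = (M *\<^sub>v x) \<bullet> (M *\<^sub>v x) + (N *\<^sub>v x) \<bullet> (N *\<^sub>v x)"
      using Mxc Nxc MN NM
      by (simp add: add_mult_distrib_mat_vec[OF Mc Nc x] add_scalar_prod_distrib[of _ m]
          scalar_prod_add_distrib[of _ m])
    also have "\<dots> \<le> s\<^sup>2 * (y \<bullet> y) + s\<^sup>2 * (z \<bullet> z)"
    proof (rule add_mono)
      show "(M *\<^sub>v x) \<bullet> (M *\<^sub>v x) \<le> s\<^sup>2 * (y \<bullet> y)"
        unfolding Mx by (rule Hle[OF y])
      \<comment> \<open>Pythagoras for \<open>Q\<close>: an orthogonal projection does not increase
        the norm.\<close>
      have "(N *\<^sub>v x) \<bullet> (N *\<^sub>v x) \<le> (H *\<^sub>v z) \<bullet> (H *\<^sub>v z)"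
        unfolding Nx orthogonal_projection_Pythagoras[OF Qc Qt QQ Hz]
        by (simp add: scalar_prod_self_nonneg)
      then show "(N *\<^sub>v x) \<bullet> (N *\<^sub>v x) \<le> s\<^sup>2 * (z \<bullet> z)"
        using Hle[OF z] by simp
    qed
    also have "\<dots> = s\<^sup>2 * (x \<bullet> x)"
      using orthogonal_projection_Pythagoras[OF Ec Et EE x]
      by (simp add: y_def z_def distrib_left)
    finally have "(vec_norm2 ((M + N) *\<^sub>v x))\<^sup>2 \<le> (s * vec_norm2 x)\<^sup>2"
      by (simp add: vec_norm2_squared power_mult_distrib)
    then show "vec_norm2 ((M + N) *\<^sub>v x) \<le> s * vec_norm2 x"
      by (rule power2_le_imp_le) (simp add: s0 vec_norm2_nonneg)
  qed (rule add_carrier_mat[OF Nc])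
  then show ?thesis
    by (simp add: M_def N_def s_def)
qed

section \<open>Linear independence of basis vectors as full column rank\<close>

lemma ordered_basis_lin_indpt:
  assumes "VectorSpace.subspace class_ring L (real_space d)" "ordered_basis d L xs"
  shows "set xs \<subseteq> L" "L \<subseteq> carrier_vec d" "\<not> module.lin_dep class_ring (real_space d) (set xs)"
proof -
  interpret V: vec_space "TYPE(real)" d .
  have sub: "submodule class_ring L (real_space d)"
    using assms(1) by (simp add: VectorSpace.subspace_def)
  have vs: "vectorspace class_ring (V.vs L)"
    using V.subspace_is_vs[OF assms(1)] .
  show xsL: "set xs \<subseteq> L"
    using assms(2) by (simp add: ordered_basis_def vectorspace.basis_def[OF vs])
  show "L \<subseteq> carrier_vec d"
    using submodule.subset[OF sub] by (simp add: module_vec_def)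
  \<comment> \<open>A basis of \<open>L\<close> is independent in \<open>L\<close> as a space of its
    own; this is transferred to the ambient space, where the matrices live.\<close>
  show "\<not> module.lin_dep class_ring (real_space d) (set xs)"
    using assms(2) V.span_li_not_depend(2)[OF xsL sub]
    by (simp add: ordered_basis_def vectorspace.basis_def[OF vs])
qed

text \<open>A nonzero kernel vector is a nontrivial relation among the columns. Dependence concerns
  the set of columns, so \<open>distinct ys\<close> excludes relations that merely cancel a repeated
  column.\<close>

lemma mat_of_cols_inj_if_lin_indpt:
  assumes "\<not> module.lin_dep class_ring (real_space d) S" "set ys \<subseteq> S" "S \<subseteq> carrier_vec d"
    "distinct ys"
    and "v \<in> carrier_vec (length ys)" "mat_of_cols d ys *\<^sub>v v = 0\<^sub>v d"
  shows "v = 0\<^sub>v (length ys)"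
proof (rule ccontr)
  interpret V: vec_space "TYPE(real)" d .
  have ys: "set ys \<subseteq> carrier_vec d"
    using assms(2,3) by blast
  assume "v \<noteq> 0\<^sub>v (length ys)"
  then have "V.lin_dep (set (cols (mat_of_cols d ys)))"
    using V.lin_depI[OF _ assms(5) _ assms(6)] ys assms(4) by simp
  then have "V.lin_dep (set ys)"
    using ys by simp
  with assms(1-3) show False
    using V.subset_li_is_li by blast
qed

section \<open>Application to a basis of a Lagrangian subspace\<close>

theorem theorem4:
  fixes n :: nat and L :: "real vec set" and xs :: "real vec list"
  assumes "n \<ge> 1"
    and "lagrangian n L"
    and "length xs = n"
    and "ordered_basis (2 * n) L xs"
  shows "\<forall>H \<in> HK n xs. spectral_norm (H_hat n xs) \<le> spectral_norm H"
proof
  fix H assume H: "H \<in> HK n xs"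
  define k where "k = n - 1"
  have iso: "isotropic n L"
    using assms(2) by (simp add: lagrangian_def)
  then have "VectorSpace.subspace class_ring L (real_space (2 * n))"
    by (simp add: isotropic_def)
  note xs = ordered_basis_lin_indpt[OF this assms(4)]
  have distinct: "distinct xs"
    using assms(4) by (simp add: ordered_basis_def)
  have nth: "xs ! i \<in> L" "xs ! i \<in> carrier_vec (2 * n)" if "i < n" for i
    using that xs(1,2) assms(3) nth_mem[of i xs] by blast+
  have len: "length (butlast xs) = k" "length (tl xs) = k"
    using assms(3) by (simp_all add: k_def)
  have A: "X_L n xs \<in> carrier_mat (2 * n) k" and B: "X_R n xs \<in> carrier_mat (2 * n) k"
    using mat_of_cols_carrier(1)[of "2 * n" "butlast xs"] mat_of_cols_carrier(1)[of "2 * n" "tl xs"]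
    unfolding X_L_def X_R_def len .
  have colA: "col (X_L n xs) i = xs ! i" and colB: "col (X_R n xs) i = xs ! Suc i" if "i < k" for i
    using that len nth[of i] nth[of "Suc i"] unfolding X_L_def X_R_def
    by (simp_all add: nth_butlast nth_tl k_def)
  \<comment> \<open>The columns of \<open>X_L\<close> are the basis without its last vector, hence
    still independent.\<close>
  have "\<exists>P. is_pseudoinverse (X_L n xs) P"
  proof (rule is_pseudoinverse_exists_if_inj[OF A])
    fix v assume "v \<in> carrier_vec k" "X_L n xs *\<^sub>v v = 0\<^sub>v (2 * n)"
    then show "v = 0\<^sub>v k"
      using mat_of_cols_inj_if_lin_indpt[OF xs(3), of "butlast xs" v, unfolded len] xs(1,2) distinct
      by (auto simp: X_L_def distinct_butlast dest: in_set_butlastD)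
  qed
  then have P: "is_pseudoinverse (X_L n xs) (pseudoinverse (X_L n xs))"
    using is_pseudoinverse_pseudoinverse by blast
  have Hc: "H \<in> carrier_mat (2 * n) (2 * n)" and HH: "(J_mat n)\<^sup>T * H\<^sup>T * J_mat n = H"
    and "\<forall>k \<in> {1..<n}. H *\<^sub>v xs ! (k - 1) = xs ! k"
    using H by (auto simp: HK_def skew_hamiltonian_def)
  \<comment> \<open>The index in \<open>HK\<close> starts at 1, so position \<open>i\<close> of the
    list corresponds to \<open>k = Suc i\<close>.\<close>
  then have Hx: "H *\<^sub>v xs ! i = xs ! Suc i" if "Suc i < n" for i
    using that by (auto dest: bspec[of _ _ "Suc i"])
  have "H * X_L n xs = X_R n xs"
  proof (rule mat_col_eqI)
    fix i assume "i < dim_col (X_R n xs)"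
    then have i: "i < k" using B by simp
    then show "col (H * X_L n xs) i = col (X_R n xs) i"
      using col_mult2[OF Hc A i] Hx[of i] by (simp add: colA colB k_def)
  qed (use A B Hc in auto)
  \<comment> \<open>Every entry pairs two basis vectors through \<open>J_mat n\<close>, and both lie
    in the isotropic \<open>L\<close>.\<close>
  moreover have "(X_L n xs)\<^sup>T * (J_mat n * X_R n xs) = 0\<^sub>m k k"
  proof (rule eq_matI)
    fix i j assume ij: "i < dim_row (0\<^sub>m k k :: real mat)" "j < dim_col (0\<^sub>m k k :: real mat)"
    then have "((X_L n xs)\<^sup>T * (J_mat n * X_R n xs)) $$ (i, j) = xs ! i \<bullet> (J_mat n *\<^sub>v xs ! Suc j)"
      using A B J_mat_carrier[of n] by (simp add: colA colB col_mult2[OF J_mat_carrier B] del: col_mult)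
    also have "\<dots> = 0"
      using iso nth(1)[of i] nth(1)[of "Suc j"] ij by (simp add: isotropic_def k_def)
    finally show "((X_L n xs)\<^sup>T * (J_mat n * X_R n xs)) $$ (i, j) = 0\<^sub>m k k $$ (i, j)"
      using ij by simp
  qed (use A B in auto)
  ultimately show "spectral_norm (H_hat n xs) \<le> spectral_norm H"
    unfolding H_hat_def
    using spectral_norm_completion_le[OF A B P J_mat_carrier J_mat_orthogonal Hc HH] assms(1)
    by simp
qed

end
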